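(* Let $\Sigma$ be a finite alphabet and let $\mathcal A_i = (\Sigma, Q_i, \delta_i, q_i, F_i)$, $i\in\{1,\ldots,m\}$, be weakly acyclic and commutative (complete deterministic) automata with at most $n$ states each. Then $\bigcap_{i=1}^m L(\mathcal A_i)$ is recognizable by a weakly acyclic commutative automaton of size (number of states) $n^{|\Sigma|}$, and such an automaton is computable in polynomial time (for a fixed alphabet $\Sigma$) from $\mathcal A_1,\ldots,\mathcal A_m$.
   Context: A complete deterministic automaton is a tuple $\mathcal A=(\Sigma,Q,\delta,q_0,F)$ with finite alphabet $\Sigma$, finite state set $Q$, total transition function $\delta\colon Q\times\Sigma\to Q$ (extended to words as usual), start state $q_0\in Q$ and final state set $F\subseteq Q$; $L(\mathcal A)=\{w\in\Sigma^*\mid\delta(q_0,w)\in F\}$. It is commutative if $\delta(q,ab)=\delta(q,ba)$ for all $q\in Q$, $a,b\in\Sigma$. It is weakly acyclic if there is an ordering $q_1,\ldots,q_k$ of its states such that $\delta(q_i,a)=q_j$ for some $a\in\Sigma$ implies $i\le j$ (equivalently, the only cycles are self-loops). *)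

theory Defs
  imports Main "HOL-Computational_Algebra.Polynomial"
begin

section \<open>Complete deterministic automata\<close>

record ('a, 'q) dfa =
  alphabet :: "'a set"
  states :: "'q set"
  delta :: "'q \<Rightarrow> 'a \<Rightarrow> 'q"
  start :: 'q
  final :: "'q set"

definition complete_dfa :: "('a, 'q) dfa \<Rightarrow> bool" where
  "complete_dfa A \<longleftrightarrow>
     finite (alphabet A) \<and> finite (states A) \<and>
     (\<forall>q\<in>states A. \<forall>a\<in>alphabet A. delta A q a \<in> states A) \<and>
     start A \<in> states A \<and> final A \<subseteq> states A"

definition delta_word :: "('a, 'q) dfa \<Rightarrow> 'q \<Rightarrow> 'a list \<Rightarrow> 'q" where
  "delta_word A q w = foldl (delta A) q w"

definition lang :: "('a, 'q) dfa \<Rightarrow> 'a list set" where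
  "lang A = {w \<in> lists (alphabet A). delta_word A (start A) w \<in> final A}"

definition commutative :: "('a, 'q) dfa \<Rightarrow> bool" where
  "commutative A \<longleftrightarrow>
     (\<forall>q\<in>states A. \<forall>a\<in>alphabet A. \<forall>b\<in>alphabet A.
        delta_word A q [a, b] = delta_word A q [b, a])"

definition weakly_acyclic :: "('a, 'q) dfa \<Rightarrow> bool" where
  "weakly_acyclic A \<longleftrightarrow>
     (\<exists>qs. distinct qs \<and> set qs = states A \<and>
        (\<forall>i<length qs. \<forall>j<length qs.
           (\<exists>a\<in>alphabet A. delta A (qs ! i) a = qs ! j) \<longrightarrow> i \<le> j))"

definition wac_dfa :: "'a set \<Rightarrow> ('a, 'q) dfa \<Rightarrow> bool" where
  "wac_dfa Sig A \<longleftrightarrow>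
     complete_dfa A \<and> alphabet A = Sig \<and> weakly_acyclic A \<and> commutative A"

definition intersection_dfa ::
  "'a set \<Rightarrow> nat \<Rightarrow> nat \<Rightarrow> (nat \<Rightarrow> ('a, 'q) dfa) \<Rightarrow> ('a, 'p) dfa \<Rightarrow> bool" where
  "intersection_dfa Sig m n A B \<longleftrightarrow>
     wac_dfa Sig B \<and> card (states B) = n ^ card Sig \<and>
     lang B = (\<Inter>i\<in>{1..m}. lang (A i))"

section \<open>Polynomial time\<close>

text \<open>
  The model of computation is a random access machine with addition and truncated
  subtraction, programmed with structured control flow and charged one time unit per
  elementary operation or test. As there is no multiplication, the bit length of the
  largest number grows by at most one per step, so polynomial time on this machine agrees
  with polynomial time on Turing machines (Cook and Reckhow). A program mentions only
  finitely many registers; unbounded storage is the heap, addressed through registers.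
\<close>

datatype com =
    Skip
  | Const nat nat
  | Add nat nat nat
  | Sub nat nat nat
  | Load nat nat
  | Store nat nat
  | Emit nat
  | Seq com com
  | If nat com com
  | While nat com

record ram =
  regs :: "nat \<Rightarrow> nat"
  heap :: "nat \<Rightarrow> nat"
  out :: "nat list"

text \<open>\<open>big_step c s t s'\<close>: started in \<open>s\<close>, the program \<open>c\<close> halts in \<open>s'\<close> after \<open>t\<close> time units.\<close>

inductive big_step :: "com \<Rightarrow> ram \<Rightarrow> nat \<Rightarrow> ram \<Rightarrow> bool" where
  Skip: "big_step Skip s 1 s"
| Const: "big_step (Const r k) s 1 (s\<lparr>regs := (regs s)(r := k)\<rparr>)"
| Add: "big_step (Add r x y) s 1 (s\<lparr>regs := (regs s)(r := regs s x + regs s y)\<rparr>)"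
| Sub: "big_step (Sub r x y) s 1 (s\<lparr>regs := (regs s)(r := regs s x - regs s y)\<rparr>)"
| Load: "big_step (Load r x) s 1 (s\<lparr>regs := (regs s)(r := heap s (regs s x))\<rparr>)"
| Store: "big_step (Store x r) s 1 (s\<lparr>heap := (heap s)(regs s x := regs s r)\<rparr>)"
| Emit: "big_step (Emit r) s 1 (s\<lparr>out := out s @ [regs s r]\<rparr>)"
| Seq: "big_step c1 s t1 s' \<Longrightarrow> big_step c2 s' t2 s'' \<Longrightarrow>
    big_step (Seq c1 c2) s (t1 + t2) s''"
| IfTrue: "regs s r \<noteq> 0 \<Longrightarrow> big_step c1 s t s' \<Longrightarrow> big_step (If r c1 c2) s (1 + t) s'"
| IfFalse: "regs s r = 0 \<Longrightarrow> big_step c2 s t s' \<Longrightarrow> big_step (If r c1 c2) s (1 + t) s'"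
| WhileFalse: "regs s r = 0 \<Longrightarrow> big_step (While r c) s 1 s"
| WhileTrue: "regs s r \<noteq> 0 \<Longrightarrow> big_step c s t1 s' \<Longrightarrow> big_step (While r c) s' t2 s'' \<Longrightarrow>
    big_step (While r c) s (1 + t1 + t2) s''"

inductive_cases big_step_elims:
  "big_step Skip s t s'" "big_step (Const r k) s t s'" "big_step (Add r x y) s t s'"
  "big_step (Sub r x y) s t s'" "big_step (Load r x) s t s'" "big_step (Store x r) s t s'"
  "big_step (Emit r) s t s'" "big_step (Seq c1 c2) s t s'" "big_step (If r c1 c2) s t s'"

inductive_cases big_step_WhileE: "big_step (While r c) s t s'"

lemma big_step_deterministic:
  "big_step c s t s' \<Longrightarrow> big_step c s u s'' \<Longrightarrow> u = t \<and> s'' = s'"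
proof (induction arbitrary: u s'' rule: big_step.induct)
  case (Seq c1 s t1 s1 c2 t2 s2)
  from Seq.prems obtain u1 r u2
    where "big_step c1 s u1 r" "big_step c2 r u2 s''" "u = u1 + u2"
    by (rule big_step_elims)
  with Seq.IH show ?case by blast
next
  case (IfTrue s r c1 t s1 c2)
  from IfTrue.prems IfTrue.hyps obtain v where "big_step c1 s v s''" "u = 1 + v"
    by (auto elim: big_step_elims)
  with IfTrue.IH show ?case by blast
next
  case (IfFalse s r c2 t s1 c1)
  from IfFalse.prems IfFalse.hyps obtain v where "big_step c2 s v s''" "u = 1 + v"
    by (auto elim: big_step_elims)
  with IfFalse.IH show ?case by blast
next
  case (WhileFalse s r c)
  from WhileFalse.prems WhileFalse.hyps show ?case
    by (auto elim: big_step_WhileE)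
next
  case (WhileTrue s r c t1 s1 t2 s2)
  from WhileTrue.prems WhileTrue.hyps(1) obtain u1 q u2
    where "big_step c s u1 q" "big_step (While r c) q u2 s''" "u = 1 + u1 + u2"
    by (cases rule: big_step_WhileE) auto
  with WhileTrue.IH show ?case by blast
qed (auto elim: big_step_elims)

definition init_ram :: "nat list \<Rightarrow> ram" where
  "init_ram xs =
     \<lparr>regs = (\<lambda>r. if r = 0 then length xs else 0),
      heap = (\<lambda>i. if i < length xs then xs ! i else 0),
      out = []\<rparr>"

text \<open>
  A search problem is a set of pairs of an input word sequence and the set of its
  admissible outputs. The size of an input is its number of words, which is at most its
  bit length. If an input sequence occurs in several pairs, the output of the program has
  to be admissible for all of them.
\<close>

definition poly_time_solvable :: "(nat list \<times> nat list set) set \<Rightarrow> bool" where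
  "poly_time_solvable I \<longleftrightarrow>
     (\<exists>(c :: com) (p :: nat poly). \<forall>(xs, Y)\<in>I. \<exists>t s.
        big_step c (init_ram xs) t s \<and> t \<le> poly p (length xs) \<and> out s \<in> Y)"

section \<open>Encoding of automata\<close>

text \<open>
  Relative to an enumeration \<open>as\<close> of the alphabet and an enumeration \<open>qs\<close> of the states, an
  automaton is written as the number of states, the start state, one acceptance bit for
  each state, and the transition table row by row.
\<close>

definition position :: "'q list \<Rightarrow> 'q \<Rightarrow> nat" where
  "position qs q = length (takeWhile (\<lambda>p. p \<noteq> q) qs)"

definition dfa_code :: "'a list \<Rightarrow> 'q list \<Rightarrow> ('a, 'q) dfa \<Rightarrow> nat list" where
  "dfa_code as qs A =
     [length qs, position qs (start A)] @
     map (\<lambda>q. if q \<in> final A then 1 else 0) qs @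
     concat (map (\<lambda>q. map (\<lambda>a. position qs (delta A q a)) as) qs)"

definition enumerates :: "'q list \<Rightarrow> 'q set \<Rightarrow> bool" where
  "enumerates qs Q \<longleftrightarrow> distinct qs \<and> set qs = Q"

definition dfas_code ::
  "'a list \<Rightarrow> nat \<Rightarrow> (nat \<Rightarrow> 'q list) \<Rightarrow> (nat \<Rightarrow> ('a, 'q) dfa) \<Rightarrow> nat list" where
  "dfas_code as m qs A = m # concat (map (\<lambda>i. dfa_code as (qs i) (A i)) [1..<Suc m])"

definition intersection_codes ::
  "'a list \<Rightarrow> nat \<Rightarrow> nat \<Rightarrow> (nat \<Rightarrow> ('a, 'q) dfa) \<Rightarrow> nat list set" where
  "intersection_codes as m n A =
     {dfa_code as ps B | ps (B :: ('a, nat) dfa).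
        intersection_dfa (set as) m n A B \<and> enumerates ps (states B)}"

text \<open>
  The polynomial time claim for a number \<open>n\<close> of states has two readings: \<open>n\<close> is the maximal
  number of states of the given automata and only these are the input, or \<open>n\<close> is any upper
  bound; then it has to be part of the input, in unary (\<open>n\<close> ones and a zero), since the
  output has \<open>n ^ card (set as)\<close> states.
\<close>

definition max_instances ::
  "'a list \<Rightarrow> 'q itself \<Rightarrow> (nat list \<times> nat list set) set" where
  "max_instances as _ =
     {(dfas_code as m qs A, intersection_codes as m n A)
        | m n qs (A :: nat \<Rightarrow> ('a, 'q) dfa).
        1 \<le> m \<and>
        (\<forall>i\<in>{1..m}. wac_dfa (set as) (A i) \<and> enumerates (qs i) (states (A i))) \<and>
        n = Max ((\<lambda>i. card (states (A i))) ` {1..m})}"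

definition bound_instances ::
  "'a list \<Rightarrow> 'q itself \<Rightarrow> (nat list \<times> nat list set) set" where
  "bound_instances as _ =
     {(replicate n 1 @ [0] @ dfas_code as m qs A, intersection_codes as m n A)
        | m n qs (A :: nat \<Rightarrow> ('a, 'q) dfa).
        1 \<le> m \<and>
        (\<forall>i\<in>{1..m}. wac_dfa (set as) (A i) \<and> enumerates (qs i) (states (A i))) \<and>
        (\<forall>i\<in>{1..m}. card (states (A i)) \<le> n)}"

end

theory Submission
  imports Defs
begin

text \<open>
  By commutativity the state reached on a word depends only on its letter counts, and by weak
  acyclicity reading a letter more than \<open>n - 1\<close> times has the same effect as reading it \<open>n - 1\<close>
  times. Hence the \<open>n ^ k\<close> vectors of letter counts saturating at \<open>n - 1\<close> serve as states for the
  intersection, a vector being final if all given automata accept the word with these counts.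
  A vector is stored as a number with \<open>k\<close> digits in base \<open>n\<close>, the first letter having the most
  significant digit. The program runs through these numbers; it gets the digits by repeatedly
  subtracting powers of \<open>n\<close>, and each subtraction is one step of the simulated automaton.
\<close>

section \<open>Timed Hoare triples\<close>

text \<open>The link between both halves is a canonical word: \<open>word as n q\<close> spells out
  the counts coded by \<open>q\<close> in the order of \<open>as\<close>, and each given automaton
  ends in the same state on it as on any word that leads the counter automaton to \<open>q\<close>.
  So finality of \<open>q\<close> is decided by running the automata one at a time; their product,
  whose size can be exponential in \<open>m\<close>, is never formed. The machine has neither
  multiplication nor division. For a fixed alphabet, \<open>k\<close> is a constant of the program,
  and extracting a digit costs fewer than \<open>n\<close> subtractions, so the dominant part of the
  work is of order \<open>n ^ k * m * n\<close> up to factors depending on \<open>k\<close>. The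
  program is verified for an arbitrary heap, and only then is the heap taken to be an encoded input.
  The two readings of the claim differ only in how \<open>n\<close> is found.\<close>

definition triple :: "(ram \<Rightarrow> bool) \<Rightarrow> com \<Rightarrow> nat \<Rightarrow> (ram \<Rightarrow> bool) \<Rightarrow> bool" where
  "triple P c T Q \<longleftrightarrow> (\<forall>s. P s \<longrightarrow> (\<exists>t s'. big_step c s t s' \<and> t \<le> T \<and> Q s'))"

lemma triple_conseq:
  assumes "triple P c T Q" "T \<le> T'" "\<And>s. P' s \<Longrightarrow> P s" "\<And>s. Q s \<Longrightarrow> Q' s"
  shows "triple P' c T' Q'"
  using assms unfolding triple_def by (meson order_trans)

lemma triple_Seq:
  assumes "triple P c1 T1 Q" "triple Q c2 T2 R"
  shows "triple P (Seq c1 c2) (T1 + T2) R"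
  unfolding triple_def
proof (intro allI impI)
  fix s assume "P s"
  then obtain t1 s1 where 1: "big_step c1 s t1 s1" "t1 \<le> T1" "Q s1"
    using assms(1) unfolding triple_def by blast
  then obtain t2 s2 where 2: "big_step c2 s1 t2 s2" "t2 \<le> T2" "R s2"
    using assms(2) unfolding triple_def by blast
  then show "\<exists>t s'. big_step (Seq c1 c2) s t s' \<and> t \<le> T1 + T2 \<and> R s'"
    using big_step.Seq[OF 1(1) 2(1)] 1(2) by (meson add_le_mono)
qed

text \<open>Indexing the invariant by the completed rounds, with the total \<open>d\<close> known in
  advance, gives termination and time bound at once. Each round pays one unit for its test; the
  leading 1 is the failing test.\<close>

lemma triple_While:
  assumes body: "\<And>i. i < d \<Longrightarrow> triple (I i) c T (I (Suc i))"
    and test: "\<And>i s. i \<le> d \<Longrightarrow> I i s \<Longrightarrow> regs s r \<noteq> 0 \<longleftrightarrow> i < d"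
  shows "triple (I 0) (While r c) (1 + d * (1 + T)) (I d)"
proof -
  have "\<exists>t s'. big_step (While r c) s t s' \<and> t \<le> 1 + (d - i) * (1 + T) \<and> I d s'"
    if "i \<le> d" "I i s" for i s
    using that
  proof (induction "d - i" arbitrary: i s)
    case 0
    then have "i = d" "regs s r = 0" using test by auto
    then show ?case using big_step.WhileFalse[of s r c] 0 by fastforce
  next
    case (Suc e)
    then have "i < d" "regs s r \<noteq> 0" using test by auto
    obtain t1 s1 where 1: "big_step c s t1 s1" "t1 \<le> T" "I (Suc i) s1"
      using body[OF \<open>i < d\<close>] Suc.prems(2) unfolding triple_def by blast
    have "e = d - Suc i" using Suc.hyps(2) by simp
    then obtain t2 s2 where 2: "big_step (While r c) s1 t2 s2"
        "t2 \<le> 1 + (d - Suc i) * (1 + T)" "I d s2"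
      using Suc.hyps(1)[of "Suc i" s1] 1(3) \<open>i < d\<close> by auto
    have "d - i = Suc (d - Suc i)" using \<open>i < d\<close> by simp
    then have "1 + t1 + t2 \<le> 1 + (d - i) * (1 + T)" using 1(2) 2(2) by simp
    then show ?case using big_step.WhileTrue[OF \<open>regs s r \<noteq> 0\<close> 1(1) 2(1)] 2(3) by blast
  qed
  from this[of 0] show ?thesis unfolding triple_def by simp
qed

definition block :: "com list \<Rightarrow> com" where
  "block cs = foldr Seq cs Skip"

lemma block_simps [simp]: "block [] = Skip" "block (c # cs) = Seq c (block cs)"
  by (simp_all add: block_def)

text \<open>The extra unit pays for the \<open>Skip\<close> that closes a block. The induction runs
  downwards from \<open>k\<close>, since \<open>Seq\<close> splits off the first command.\<close>

lemma triple_block_map: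
  assumes "\<And>i. i < k \<Longrightarrow> triple (I i) (f i) T (I (Suc i))"
  shows "triple (I 0) (block (map f [0..<k])) (k * T + 1) (I k)"
proof -
  have "triple (I i) (block (map f [i..<k])) ((k - i) * T + 1) (I k)" if "i \<le> k" for i
    using that
  proof (induction i rule: inc_induct)
    case base
    show ?case using big_step.Skip by (auto simp: triple_def)
  next
    case (step i)
    have eq: "(k - i) * T + 1 = T + ((k - Suc i) * T + 1)"
      using Suc_diff_Suc[OF step.hyps(2)] by (metis add.assoc mult_Suc)
    have "block (map f [i..<k]) = Seq (f i) (block (map f [Suc i..<k]))"
      using step.hyps(2) by (simp add: upt_conv_Cons)
    then show ?case
      unfolding eq using triple_Seq[OF assms step.IH] step.hyps(2) by simp
  qed
  from this[of 0] show ?thesis by simp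
qed

section \<open>Symbolic evaluation of loop-free programs\<close>

fun exec :: "com \<Rightarrow> ram \<Rightarrow> ram" where
  "exec (Const r c) s = s\<lparr>regs := (regs s)(r := c)\<rparr>"
| "exec (Add r x y) s = s\<lparr>regs := (regs s)(r := regs s x + regs s y)\<rparr>"
| "exec (Sub r x y) s = s\<lparr>regs := (regs s)(r := regs s x - regs s y)\<rparr>"
| "exec (Load r x) s = s\<lparr>regs := (regs s)(r := heap s (regs s x))\<rparr>"
| "exec (Store x r) s = s\<lparr>heap := (heap s)(regs s x := regs s r)\<rparr>"
| "exec (Emit r) s = s\<lparr>out := out s @ [regs s r]\<rparr>"
| "exec (Seq c d) s = exec d (exec c s)"
| "exec (If r c d) s = (if regs s r \<noteq> 0 then exec c s else exec d s)"
| "exec _ s = s"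

fun loop_free :: "com \<Rightarrow> bool" where
  "loop_free (Seq c d) = (loop_free c \<and> loop_free d)"
| "loop_free (If r c d) = (loop_free c \<and> loop_free d)"
| "loop_free (While r c) = False"
| "loop_free _ = True"

text \<open>Only an upper bound: a conditional is charged for both branches, which keeps the cost
  independent of the state.\<close>

fun cost :: "com \<Rightarrow> nat" where
  "cost (Seq c d) = cost c + cost d"
| "cost (If r c d) = 1 + cost c + cost d"
| "cost _ = 1"

lemma big_step_exec:
  "loop_free c \<Longrightarrow> \<exists>t\<le>cost c. big_step c s t (exec c s)"
proof (induction c arbitrary: s)
  case (Seq c d)
  then obtain t u where "t \<le> cost c" "big_step c s t (exec c s)"
    "u \<le> cost d" "big_step d (exec c s) u (exec d (exec c s))" by fastforce
  then show ?case using big_step.Seq by (fastforce intro!: exI[of _ "t + u"])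
next
  case (If r c d)
  then obtain t u where *: "t \<le> cost c" "big_step c s t (exec c s)"
    "u \<le> cost d" "big_step d s u (exec d s)" by fastforce
  show ?case
  proof (cases "regs s r = 0")
    case True
    then show ?thesis using big_step.IfFalse[OF True *(4)] *(3) by (intro exI[of _ "1 + u"]) simp
  next
    case False
    then show ?thesis using big_step.IfTrue[OF False *(2)] *(1) by (intro exI[of _ "1 + t"]) simp
  qed
qed (auto intro!: exI[of _ 1] big_step.intros[unfolded One_nat_def])

lemma triple_exec:
  assumes "loop_free c" "cost c \<le> T" "\<And>s. P s \<Longrightarrow> Q (exec c s)"
  shows "triple P c T Q"
  unfolding triple_def using big_step_exec[OF assms(1)] assms(2,3) by (meson order_trans)

text \<open>Multiplication by the constant \<open>k\<close>. With \<open>x = y\<close> the summand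
  would change along the way.\<close>

lemma block_replicate_Add:
  "loop_free (block (replicate k (Add x x y)))"
  "cost (block (replicate k (Add x x y))) = k + 1"
  "x \<noteq> y \<Longrightarrow> exec (block (replicate k (Add x x y))) s =
     s\<lparr>regs := (regs s)(x := regs s x + k * regs s y)\<rparr>"
  by (induction k arbitrary: s) (auto simp: algebra_simps)

section \<open>The program\<close>

abbreviation (input) "One \<equiv> 1 :: nat"
abbreviation (input) "Bound \<equiv> 2 :: nat"
abbreviation (input) "First \<equiv> 3 :: nat"
abbreviation (input) "Num \<equiv> 4 :: nat"
abbreviation (input) "State \<equiv> 5 :: nat"
abbreviation (input) "More \<equiv> 6 :: nat"
abbreviation (input) "Count \<equiv> 7 :: nat"
abbreviation (input) "Ptr \<equiv> 8 :: nat"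
abbreviation (input) "Size \<equiv> 9 :: nat"
abbreviation (input) "Table \<equiv> 10 :: nat"
abbreviation (input) "Cur \<equiv> 11 :: nat"
abbreviation (input) "Rest \<equiv> 12 :: nat"
abbreviation (input) "Test \<equiv> 13 :: nat"
abbreviation (input) "Tmp \<equiv> 14 :: nat"
abbreviation (input) "Acc \<equiv> 15 :: nat"
text \<open>One register for each power of \<open>n\<close>; the offset keeps them apart from the
  named registers, all below 20.\<close>

definition Pow :: "nat \<Rightarrow> nat" where "Pow e = 20 + e"

lemma Pow_eq_iff [simp]:
  "Pow e = Pow f \<longleftrightarrow> e = f" "r < 20 \<Longrightarrow> Pow e \<noteq> r" "r < 20 \<Longrightarrow> r \<noteq> Pow e"
  by (auto simp: Pow_def)

abbreviation move :: "nat \<Rightarrow> nat \<Rightarrow> com" where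
  "move x y \<equiv> Seq (Const x 0) (Add x x y)"

text \<open>
  The programs are parametrized by the size \<open>k\<close> of the alphabet: products with \<open>k\<close> and the loop over
  the letters are unrolled. Nothing is stored on the heap, so the input stays in place.
\<close>

definition power_body :: "nat \<Rightarrow> com" where
  "power_body e = block [Add (Pow (Suc e)) (Pow (Suc e)) (Pow e), Sub Count Count One]"

definition power_prog :: "nat \<Rightarrow> com" where
  "power_prog e = Seq (block [Const (Pow (Suc e)) 0, move Count Bound]) (While Count (power_body e))"

text \<open>Truncated subtraction as a comparison: \<open>Test\<close> becomes nonzero exactly if
  \<open>Rest\<close> is at least the power held in \<open>Pow e\<close>.\<close>

definition rest_test :: "nat \<Rightarrow> com" where
  "rest_test e = block [Add Test Rest One, Sub Test Test (Pow e)]"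

text \<open>The table is stored row by row, so the successor of \<open>Cur\<close> under letter
  \<open>j\<close> is found at address \<open>Table + k * Cur + j\<close>.\<close>

definition read_body :: "nat \<Rightarrow> nat \<Rightarrow> com" where
  "read_body k j = block
     [Sub Rest Rest (Pow (k - Suc j)),
      Const Tmp j, Add Tmp Tmp Table, block (replicate k (Add Tmp Tmp Cur)), Load Cur Tmp,
      rest_test (k - Suc j)]"

definition read_letter :: "nat \<Rightarrow> nat \<Rightarrow> com" where
  "read_letter k j = Seq (rest_test (k - Suc j)) (While Test (read_body k j))"

text \<open>From \<open>Ptr\<close> on, an automaton occupies its size, its start state,
  \<open>Size\<close> acceptance bits and the table, whence
  \<open>Table = Ptr + 2 + Size\<close>.\<close>

definition dfa_begin :: "com" where
  "dfa_begin = block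
     [Load Size Ptr, Add Tmp Ptr One, Load Cur Tmp, Add Tmp Tmp One, Add Table Tmp Size,
      move Rest State]"

definition next_dfa :: "nat \<Rightarrow> com" where
  "next_dfa k = block
     [move Ptr Table, block (replicate k (Add Ptr Ptr Size)), Sub Count Count One]"

text \<open>\<open>Acc - (1 - bit)\<close> acts as a conjunction: \<open>Acc\<close> drops to 0 at
  the first rejecting automaton and stays there.\<close>

definition dfa_end :: "nat \<Rightarrow> com" where
  "dfa_end k = block
     [Add Tmp Ptr One, Add Tmp Tmp One, Add Tmp Tmp Cur, Load Tmp Tmp, Sub Tmp One Tmp,
      Sub Acc Acc Tmp, next_dfa k]"

definition run_dfa :: "nat \<Rightarrow> com" where
  "run_dfa k = Seq dfa_begin (Seq (block (map (read_letter k) [0..<k])) (dfa_end k))"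

definition next_state :: "nat \<Rightarrow> com" where
  "next_state k = block [Add State State One, Sub More (Pow k) State]"

definition bit_body :: "nat \<Rightarrow> com" where
  "bit_body k = Seq (block [move Count Num, move Ptr First, Const Acc 1])
     (Seq (While Count (run_dfa k)) (Seq (Emit Acc) (next_state k)))"

text \<open>\<open>Test\<close> first decides whether the digit can grow without a carry. The
  closing \<open>rest_test\<close> then sets it up for the loop that strips this digit from
  \<open>Rest\<close>.\<close>

definition emit_succ :: "nat \<Rightarrow> nat \<Rightarrow> com" where
  "emit_succ k j = block
     [Add Tmp Rest (Pow (k - Suc j)), Sub Test (Pow (k - j)) Tmp, move Tmp State,
      If Test (Add Tmp State (Pow (k - Suc j))) Skip, Emit Tmp, rest_test (k - Suc j)]"

definition drop_digit :: "nat \<Rightarrow> com" where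
  "drop_digit e = block [Sub Rest Rest (Pow e), rest_test e]"

definition succ_prog :: "nat \<Rightarrow> nat \<Rightarrow> com" where
  "succ_prog k j = Seq (emit_succ k j) (While Test (drop_digit (k - Suc j)))"

definition row_body :: "nat \<Rightarrow> com" where
  "row_body k = Seq (move Rest State)
     (Seq (block (map (succ_prog k) [0..<k])) (next_state k))"

definition for_states :: "nat \<Rightarrow> com \<Rightarrow> com" where
  "for_states k c = Seq (block [Const State 0, move More (Pow k)]) (While More c)"

definition output_prog :: "nat \<Rightarrow> com" where
  "output_prog k = Seq (Const (Pow 0) 1)
     (Seq (block (map power_prog [0..<k]))
     (Seq (block [Emit (Pow k), Const Tmp 0, Emit Tmp])
     (Seq (for_states k (bit_body k)) (for_states k (row_body k)))))"

text \<open>With truncated subtraction, \<open>Bound + (Size - Bound)\<close> is the maximum of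
  both.\<close>

definition max_body :: "nat \<Rightarrow> com" where
  "max_body k = block
     [Load Size Ptr, Sub Tmp Size Bound, Add Bound Bound Tmp,
      Add Table Ptr One, Add Table Table One, Add Table Table Size, next_dfa k]"

definition max_input :: "nat \<Rightarrow> com" where
  "max_input k = Seq
     (block [Const One 1, Const Tmp 0, Load Num Tmp, Const First 1, Const Bound 0,
        move Ptr First, move Count Num])
     (While Count (max_body k))"

text \<open>\<open>Bound\<close> is at once the number of ones seen and the address of the next
  input word.\<close>

definition unary_body :: "com" where
  "unary_body = block [Add Bound Bound One, Load Test Bound]"

definition bound_input :: "com" where
  "bound_input = Seq (block [Const One 1, Const Bound 0, Load Test Bound])
     (Seq (While Test unary_body)
       (block [Add Tmp Bound One, Load Num Tmp, Add First Tmp One]))"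

section \<open>What the program computes\<close>

definition digit :: "nat \<Rightarrow> nat \<Rightarrow> nat \<Rightarrow> nat" where
  "digit n e q = q div n ^ e mod n"

text \<open>The test says that the digit of letter \<open>j\<close> is less than \<open>n - 1\<close>.\<close>

definition incr :: "nat \<Rightarrow> nat \<Rightarrow> nat \<Rightarrow> nat \<Rightarrow> nat" where
  "incr n k q j = (if q mod n ^ (k - j) + n ^ (k - Suc j) < n ^ (k - j)
     then q + n ^ (k - Suc j) else q)"

text \<open>When digit \<open>e\<close> is due, \<open>Rest\<close> holds
  \<open>q mod n ^ Suc e\<close>, so its quotient by the current power is that digit.\<close>

lemma digit_conv_mod: "q mod n ^ Suc e div n ^ e = digit n e q"
  using mod_mult2_eq[of q "n ^ e" n] by (cases "n ^ e = 0") (auto simp: digit_def mult.commute)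


lemma digit_less: "n > 0 \<Longrightarrow> digit n e q < n"
  by (simp add: digit_def)

text \<open>The loop that divides by repeated subtraction runs for exactly \<open>r div p\<close> rounds.\<close>

lemma digit_test:
  fixes r p x :: nat
  assumes "p > 0" "x \<le> r div p"
  shows "r - x * p + 1 - p > 0 \<longleftrightarrow> x < r div p"
proof
  assume "r - x * p + 1 - p > 0"
  then have "Suc x * p \<le> r" using assms by auto
  then show "x < r div p" using assms(1) by (simp add: Suc_le_eq[symmetric] less_eq_div_iff_mult_less_eq)
next
  assume "x < r div p"
  then have "Suc x * p \<le> r" using assms(1) by (simp add: Suc_le_eq[symmetric] less_eq_div_iff_mult_less_eq)
  then show "r - x * p + 1 - p > 0" by simp
qed

text \<open>The heap \<open>h\<close> is arbitrary: the effect of the program is specified by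
  arithmetic alone, and its meaning for automata is supplied later by
  \<open>encoded_input\<close>.\<close>

locale program =
  fixes h :: "nat \<Rightarrow> nat" and n k m first :: nat
  assumes n_pos: "n > 0"
begin

section \<open>Arithmetic specification and loop invariants\<close>

primrec addr :: "nat \<Rightarrow> nat" where
  "addr 0 = first"
| "addr (Suc i) = addr i + 2 + h (addr i) + k * h (addr i)"

definition step :: "nat \<Rightarrow> nat \<Rightarrow> nat \<Rightarrow> nat" where
  "step i j p = h (addr i + 2 + h (addr i) + k * p + j)"

text \<open>The position of the state that automaton \<open>i\<close> reaches on the first \<open>j\<close> digits of \<open>q\<close>.\<close>

primrec sim :: "nat \<Rightarrow> nat \<Rightarrow> nat \<Rightarrow> nat" where
  "sim i q 0 = h (addr i + 1)"
| "sim i q (Suc j) = (step i j ^^ digit n (k - Suc j) q) (sim i q j)"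

definition accepted :: "nat \<Rightarrow> nat \<Rightarrow> nat" where
  "accepted q i = (if \<forall>i'<i. h (addr i' + 2 + sim i' q k) \<noteq> 0 then 1 else 0)"

lemma accepted_Suc:
  "accepted q (Suc i) = accepted q i - (1 - h (addr i + 2 + sim i q k))"
  by (auto simp: accepted_def less_Suc_eq)

text \<open>\<open>l\<close> is the number of powers of \<open>n\<close> available so far: 0 after
  the input phase, \<open>Suc k\<close> while states are output.\<close>

definition base :: "nat \<Rightarrow> ram \<Rightarrow> bool" where
  "base l s \<longleftrightarrow> heap s = h \<and> regs s One = 1 \<and> regs s Bound = n \<and> regs s First = first \<and>
     regs s Num = m \<and> (\<forall>e<l. regs s (Pow e) = n ^ e)"

definition outer :: "nat list \<Rightarrow> nat \<Rightarrow> ram \<Rightarrow> bool" where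
  "outer os q s \<longleftrightarrow> base (Suc k) s \<and> out s = os \<and> regs s State = q \<and> regs s More = n ^ k - q"

definition dfa_loop :: "nat list \<Rightarrow> nat \<Rightarrow> nat \<Rightarrow> ram \<Rightarrow> bool" where
  "dfa_loop os q i s \<longleftrightarrow> outer os q s \<and> regs s Count = m - i \<and> regs s Ptr = addr i \<and>
     regs s Acc = accepted q i"

definition letter_loop :: "nat list \<Rightarrow> nat \<Rightarrow> nat \<Rightarrow> nat \<Rightarrow> ram \<Rightarrow> bool" where
  "letter_loop os q i j s \<longleftrightarrow> dfa_loop os q i s \<and>
     regs s Table = addr i + 2 + h (addr i) \<and> regs s Size = h (addr i) \<and>
     regs s Rest = q mod n ^ (k - j) \<and> regs s Cur = sim i q j"

text \<open>The same \<open>x\<close> counts subtractions from \<open>Rest\<close> and transitions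
  taken; this turns the digit into the number of times that letter \<open>j\<close> is read.\<close>

definition read_loop :: "nat list \<Rightarrow> nat \<Rightarrow> nat \<Rightarrow> nat \<Rightarrow> nat \<Rightarrow> ram \<Rightarrow> bool" where
  "read_loop os q i j x s \<longleftrightarrow> dfa_loop os q i s \<and>
     regs s Table = addr i + 2 + h (addr i) \<and> regs s Size = h (addr i) \<and>
     regs s Rest = q mod n ^ (k - j) - x * n ^ (k - Suc j) \<and>
     regs s Test = regs s Rest + 1 - n ^ (k - Suc j) \<and>
     regs s Cur = (step i j ^^ x) (sim i q j)"

definition row_loop :: "nat list \<Rightarrow> nat \<Rightarrow> nat \<Rightarrow> ram \<Rightarrow> bool" where
  "row_loop os q j s \<longleftrightarrow> outer (os @ map (incr n k q) [0..<j]) q s \<and>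
     regs s Rest = q mod n ^ (k - j)"

definition drop_loop :: "nat list \<Rightarrow> nat \<Rightarrow> nat \<Rightarrow> nat \<Rightarrow> ram \<Rightarrow> bool" where
  "drop_loop os q j x s \<longleftrightarrow> outer (os @ map (incr n k q) [0..<Suc j]) q s \<and>
     regs s Rest = q mod n ^ (k - j) - x * n ^ (k - Suc j) \<and>
     regs s Test = regs s Rest + 1 - n ^ (k - Suc j)"

definition power_loop :: "nat \<Rightarrow> nat \<Rightarrow> ram \<Rightarrow> bool" where
  "power_loop e x s \<longleftrightarrow> base (Suc e) s \<and> out s = [] \<and>
     regs s (Pow (Suc e)) = x * n ^ e \<and> regs s Count = n - x"

lemmas state_defs = base_def outer_def dfa_loop_def letter_loop_def read_loop_def
  row_loop_def drop_loop_def power_loop_def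

lemma rest_div: "j < k \<Longrightarrow> q mod n ^ (k - j) div n ^ (k - Suc j) = digit n (k - Suc j) q"
  using digit_conv_mod[of q n "k - Suc j"] by (simp add: Suc_diff_Suc)

text \<open>What the subtractions leave in \<open>Rest\<close> are the lower digits, as the next
  letter expects.\<close>

lemma rest_end:
  assumes "j < k"
  shows "q mod n ^ (k - j) - digit n (k - Suc j) q * n ^ (k - Suc j) = q mod n ^ (k - Suc j)"
proof -
  have "n ^ (k - Suc j) dvd n ^ (k - j)" by (rule le_imp_power_dvd) simp
  then show ?thesis
    by (metis assms minus_div_mult_eq_mod mod_mod_cancel rest_div)
qed

lemma rest_test_iff:
  assumes "j < k" "x \<le> digit n (k - Suc j) q"
  shows "q mod n ^ (k - j) - x * n ^ (k - Suc j) + 1 - n ^ (k - Suc j) > 0 \<longleftrightarrow>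
    x < digit n (k - Suc j) q"
  using digit_test[of "n ^ (k - Suc j)" x "q mod n ^ (k - j)"] assms n_pos
  by (simp only: rest_div) simp

lemma read_letter:
  assumes "j < k"
  shows "triple (letter_loop os q i j) (read_letter k j) (4 + n * (10 + k)) (letter_loop os q i (Suc j))"
proof -
  let ?d = "digit n (k - Suc j) q"
  have init: "triple (letter_loop os q i j) (rest_test (k - Suc j)) 3 (read_loop os q i j 0)"
    by (rule triple_exec) (use assms in \<open>simp_all add: state_defs rest_test_def\<close>)
  have "triple (read_loop os q i j 0) (While Test (read_body k j)) (1 + ?d * (1 + (9 + k)))
     (read_loop os q i j ?d)"
  proof (rule triple_While)
    fix x
    show "triple (read_loop os q i j x) (read_body k j) (9 + k) (read_loop os q i j (Suc x))"
      by (rule triple_exec)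
        (use assms in \<open>simp_all add: state_defs read_body_def rest_test_def block_replicate_Add step_def
          algebra_simps\<close>)
  next
    fix x s assume "x \<le> ?d" "read_loop os q i j x s"
    then show "regs s Test \<noteq> 0 \<longleftrightarrow> x < ?d"
      using rest_test_iff[OF assms] by (simp add: read_loop_def not_le)
  qed
  then have loop: "triple (read_loop os q i j 0) (While Test (read_body k j)) (1 + n * (10 + k))
     (letter_loop os q i (Suc j))"
  proof (rule triple_conseq)
    \<comment> \<open>The exact number of rounds depends on \<open>q\<close>; replacing it by
      \<open>n\<close> makes the time uniform over all states.\<close>
    have "?d * (10 + k) \<le> n * (10 + k)"
      using digit_less[OF n_pos] by (intro mult_right_mono) (auto simp: less_imp_le)
    then show "1 + ?d * (1 + (9 + k)) \<le> 1 + n * (10 + k)" by simp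
  qed (use assms in \<open>auto simp: letter_loop_def read_loop_def rest_end[OF assms]\<close>)
  show ?thesis
    using triple_Seq[OF init loop] by (simp add: read_letter_def)
qed

definition dfa_time :: nat where
  "dfa_time = 21 + k + k * (4 + n * (10 + k))"

lemma run_dfa:
  assumes "q < n ^ k"
  shows "triple (dfa_loop os q i) (run_dfa k) dfa_time (dfa_loop os q (Suc i))"
proof -
  \<comment> \<open>Since \<open>q < n ^ k\<close>, the initial \<open>Rest = q\<close> is
    \<open>q mod n ^ k\<close>, as the letter invariant demands at \<open>j = 0\<close>.\<close>
  have b: "triple (dfa_loop os q i) dfa_begin 8 (letter_loop os q i 0)"
    by (rule triple_exec) (use assms in \<open>simp_all add: state_defs dfa_begin_def\<close>)
  have c: "triple (letter_loop os q i k) (dfa_end k) (12 + k) (dfa_loop os q (Suc i))"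
    by (rule triple_exec)
      (simp_all add: state_defs dfa_end_def next_dfa_def block_replicate_Add accepted_Suc)
  show ?thesis
    using triple_Seq[OF b triple_Seq[OF triple_block_map[where I = "letter_loop os q i", OF read_letter] c]]
    unfolding run_dfa_def dfa_time_def by (rule triple_conseq) auto
qed

definition bit_time :: nat where
  "bit_time = 11 + m * (1 + dfa_time)"

lemma bit_body:
  assumes "q < n ^ k"
  shows "triple (outer os q) (bit_body k) bit_time (outer (os @ [accepted q m]) (Suc q))"
proof -
  have b: "triple (outer os q) (block [move Count Num, move Ptr First, Const Acc 1]) 6 (dfa_loop os q 0)"
    by (rule triple_exec) (simp_all add: state_defs accepted_def)
  have l: "triple (dfa_loop os q 0) (While Count (run_dfa k)) (1 + m * (1 + dfa_time)) (dfa_loop os q m)"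
    by (rule triple_While[where I = "dfa_loop os q"])
      (use run_dfa[OF assms] in \<open>auto simp: dfa_loop_def\<close>)
  have e: "triple (dfa_loop os q m) (Seq (Emit Acc) (next_state k)) 4 (outer (os @ [accepted q m]) (Suc q))"
    by (rule triple_exec) (simp_all add: state_defs next_state_def)
  show ?thesis
    using triple_Seq[OF b triple_Seq[OF l e]]
    unfolding bit_body_def bit_time_def by (rule triple_conseq) auto
qed

lemma succ_prog:
  assumes "j < k"
  shows "triple (row_loop os q j) (succ_prog k j) (13 + n * 6) (row_loop os q (Suc j))"
proof -
  let ?d = "digit n (k - Suc j) q"
  have init: "triple (row_loop os q j) (emit_succ k j) 12 (drop_loop os q j 0)"
    by (rule triple_exec) (use assms in \<open>simp_all add: state_defs emit_succ_def rest_test_def incr_def\<close>)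
  have "triple (drop_loop os q j 0) (While Test (drop_digit (k - Suc j))) (1 + ?d * (1 + 5))
     (drop_loop os q j ?d)"
  proof (rule triple_While)
    fix x
    show "triple (drop_loop os q j x) (drop_digit (k - Suc j)) 5 (drop_loop os q j (Suc x))"
      by (rule triple_exec)
        (use assms in \<open>simp_all add: state_defs drop_digit_def rest_test_def algebra_simps\<close>)
  next
    fix x s assume "x \<le> ?d" "drop_loop os q j x s"
    then show "regs s Test \<noteq> 0 \<longleftrightarrow> x < ?d"
      using rest_test_iff[OF assms] by (simp add: drop_loop_def not_le)
  qed
  then have loop: "triple (drop_loop os q j 0) (While Test (drop_digit (k - Suc j))) (1 + n * 6)
     (row_loop os q (Suc j))"
    by (rule triple_conseq)
      (use assms digit_less[OF n_pos, of "k - Suc j" q] in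
        \<open>auto simp: row_loop_def drop_loop_def rest_end[OF assms]\<close>)
  show ?thesis
    using triple_Seq[OF init loop] by (simp add: succ_prog_def)
qed

definition row_time :: nat where
  "row_time = 6 + k * (13 + n * 6)"

lemma row_body:
  assumes "q < n ^ k"
  shows "triple (outer os q) (row_body k) row_time (outer (os @ map (incr n k q) [0..<k]) (Suc q))"
proof -
  have b: "triple (outer os q) (move Rest State) 2 (row_loop os q 0)"
    by (rule triple_exec) (use assms in \<open>simp_all add: state_defs\<close>)
  have e: "triple (row_loop os q k) (next_state k) 3 (outer (os @ map (incr n k q) [0..<k]) (Suc q))"
    by (rule triple_exec) (simp_all add: state_defs next_state_def)
  show ?thesis
    using triple_Seq[OF b triple_Seq[OF triple_block_map[where I = "row_loop os q", OF succ_prog] e]]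
    unfolding row_body_def row_time_def by (rule triple_conseq) auto
qed

lemma for_states:
  assumes "\<And>os q. q < n ^ k \<Longrightarrow> triple (outer os q) c T (outer (os @ f q) (Suc q))"
  shows "triple (\<lambda>s. base (Suc k) s \<and> out s = os) (for_states k c) (5 + n ^ k * (1 + T))
    (\<lambda>s. base (Suc k) s \<and> out s = os @ concat (map f [0..<n ^ k]))"
proof -
  let ?I = "\<lambda>q. outer (os @ concat (map f [0..<q])) q"
  have b: "triple (\<lambda>s. base (Suc k) s \<and> out s = os) (block [Const State 0, move More (Pow k)]) 4 (?I 0)"
    by (rule triple_exec) (simp_all add: state_defs)
  have l: "triple (?I 0) (While More c) (1 + n ^ k * (1 + T)) (?I (n ^ k))"
  proof (rule triple_While)
    fix q assume "q < n ^ k"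
    then show "triple (?I q) c T (?I (Suc q))"
      using assms[of q "os @ concat (map f [0..<q])"] by simp
  qed (auto simp: outer_def)
  show ?thesis
    using triple_Seq[OF b l] unfolding for_states_def by (rule triple_conseq) (auto simp: outer_def)
qed

lemma power_prog:
  "triple (\<lambda>s. base (Suc e) s \<and> out s = []) (power_prog e) (5 + n * 4)
     (\<lambda>s. base (Suc (Suc e)) s \<and> out s = [])"
proof -
  have b: "triple (\<lambda>s. base (Suc e) s \<and> out s = []) (block [Const (Pow (Suc e)) 0, move Count Bound]) 4
      (power_loop e 0)"
    by (rule triple_exec) (simp_all add: state_defs)
  have l: "triple (power_loop e 0) (While Count (power_body e)) (1 + n * (1 + 3)) (power_loop e n)"
  proof (rule triple_While)
    fix x
    show "triple (power_loop e x) (power_body e) 3 (power_loop e (Suc x))"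
      by (rule triple_exec) (simp_all add: state_defs power_body_def)
  qed (auto simp: power_loop_def)
  show ?thesis
    using triple_Seq[OF b l] unfolding power_prog_def
    by (rule triple_conseq) (auto simp: state_defs less_Suc_eq)
qed

text \<open>This follows the layout of \<open>dfa_code\<close>; the start state 0 is the zero
  vector.\<close>

definition result :: "nat list" where
  "result = [n ^ k, 0] @ map (\<lambda>q. accepted q m) [0..<n ^ k] @
     concat (map (\<lambda>q. map (incr n k q) [0..<k]) [0..<n ^ k])"

definition output_time :: nat where
  "output_time = 16 + k * (5 + n * 4) + n ^ k * (1 + bit_time) + n ^ k * (1 + row_time)"

lemma output_prog:
  "triple (\<lambda>s. base 0 s \<and> out s = []) (output_prog k) output_time (\<lambda>s. out s = result)"
proof -
  have a: "triple (\<lambda>s. base 0 s \<and> out s = []) (Const (Pow 0) 1) 1 (\<lambda>s. base (Suc 0) s \<and> out s = [])"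
    by (rule triple_exec) (simp_all add: state_defs)
  have c: "triple (\<lambda>s. base (Suc k) s \<and> out s = []) (block [Emit (Pow k), Const Tmp 0, Emit Tmp]) 4
     (\<lambda>s. base (Suc k) s \<and> out s = [n ^ k, 0])"
    by (rule triple_exec) (simp_all add: state_defs)
  note b = triple_block_map[where I = "\<lambda>e s. base (Suc e) s \<and> out s = []" and k = k, OF power_prog]
  show ?thesis
    using triple_Seq[OF a triple_Seq[OF b triple_Seq[OF c
      triple_Seq[OF for_states[OF bit_body] for_states[OF row_body]]]]]
    unfolding output_prog_def output_time_def
    by (rule triple_conseq) (auto simp: result_def)
qed

section \<open>Obtaining the bound \<open>n\<close> from the input\<close>

primrec max_size :: "nat \<Rightarrow> nat" where
  "max_size 0 = 0"
| "max_size (Suc i) = max (max_size i) (h (addr i))"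

lemma max_input:
  assumes "h 0 = m" "first = 1" "max_size m = n"
  shows "triple (\<lambda>s. heap s = h \<and> out s = []) (max_input k) (11 + m * (13 + k))
    (\<lambda>s. base 0 s \<and> out s = [])"
proof -
  let ?I = "\<lambda>i s. heap s = h \<and> out s = [] \<and> regs s One = 1 \<and> regs s Bound = max_size i \<and>
    regs s First = first \<and> regs s Num = m \<and> regs s Count = m - i \<and> regs s Ptr = addr i"
  have b: "triple (\<lambda>s. heap s = h \<and> out s = [])
     (block [Const One 1, Const Tmp 0, Load Num Tmp, Const First 1, Const Bound 0,
        move Ptr First, move Count Num]) 10 (?I 0)"
    by (rule triple_exec) (simp_all only: max_size.simps addr.simps, simp_all add: assms(1,2))
  have l: "triple (?I 0) (While Count (max_body k)) (1 + m * (1 + (12 + k))) (?I m)"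
  proof (rule triple_While)
    fix i
    show "triple (?I i) (max_body k) (12 + k) (?I (Suc i))"
      by (rule triple_exec)
        (simp_all add: max_body_def next_dfa_def block_replicate_Add max_def)
  qed auto
  show ?thesis
    using triple_Seq[OF b l] unfolding max_input_def
    by (rule triple_conseq) (simp_all add: base_def assms(3))
qed

lemma bound_input:
  assumes "\<And>i. i < n \<Longrightarrow> h i = 1" "h n = 0" "h (n + 1) = m" "first = n + 2"
  shows "triple (\<lambda>s. heap s = h \<and> out s = []) bound_input (9 + n * 4)
    (\<lambda>s. base 0 s \<and> out s = [])"
proof -
  let ?I = "\<lambda>i s. heap s = h \<and> out s = [] \<and> regs s One = 1 \<and> regs s Bound = i \<and> regs s Test = h i"
  have b: "triple (\<lambda>s. heap s = h \<and> out s = [])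
     (block [Const One 1, Const Bound 0, Load Test Bound]) 4 (?I 0)"
    by (rule triple_exec) simp_all
  have l: "triple (?I 0) (While Test unary_body) (1 + n * (1 + 3)) (?I n)"
  proof (rule triple_While)
    fix i
    show "triple (?I i) unary_body 3 (?I (Suc i))"
      by (rule triple_exec) (simp_all add: unary_body_def)
    fix s assume "i \<le> n" "?I i s"
    then show "regs s Test \<noteq> 0 \<longleftrightarrow> i < n" using assms(1,2) by (cases "i = n") auto
  qed
  have c: "triple (?I n) (block [Add Tmp Bound One, Load Num Tmp, Add First Tmp One]) 4
     (\<lambda>s. base 0 s \<and> out s = [])"
    by (rule triple_exec) (simp_all only: base_def, use assms in simp_all)
  show ?thesis
    using triple_Seq[OF b triple_Seq[OF l c]] unfolding bound_input_def
    by (rule triple_conseq) auto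
qed

end


section \<open>Digits\<close>

text \<open>The first hypothesis says that adding \<open>n ^ e\<close> causes no carry out of the
  lowest \<open>Suc e\<close> digits.\<close>

lemma div_power_add:
  fixes n :: nat
  assumes "q mod n ^ Suc e + n ^ e < n ^ Suc e" "e < f"
  shows "(q + n ^ e) div n ^ f = q div n ^ f"
proof -
  let ?P = "n ^ Suc e"
  have "q + n ^ e = (q mod ?P + n ^ e) + q div ?P * ?P"
    using mod_div_mult_eq[of q ?P] by linarith
  then have "(q + n ^ e) div ?P = (q mod ?P + n ^ e + q div ?P * ?P) div ?P"
    by (rule arg_cong)
  also have "\<dots> = q div ?P"
    using gr_implies_not0[OF assms(1)] div_less[OF assms(1)]
    by (simp only: div_mult_self1 add_0_right not_False_eq_True)
  finally have "(q + n ^ e) div ?P = q div ?P" .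
  moreover have "n ^ f = n ^ Suc e * n ^ (f - Suc e)"
    unfolding power_add[symmetric] using assms(2) by simp
  ultimately show ?thesis by (simp only: div_mult2_eq)
qed

lemma digit_add:
  assumes "n > 0" "q mod n ^ Suc e + n ^ e < n ^ Suc e"
  shows "digit n f (q + n ^ e) = (if f = e then Suc (digit n e q) else digit n f q)"
proof (cases f e rule: linorder_cases)
  case less
  \<comment> \<open>\<open>n ^ e\<close> is a multiple of \<open>n ^ Suc f\<close>, so the quotient
    grows by a multiple of \<open>n\<close> and the digit stays.\<close>
  then have e: "n ^ e = n * n ^ (e - Suc f) * n ^ f"
    unfolding power_Suc[symmetric] power_add[symmetric] by simp
  have "(q + n ^ e) div n ^ f = q div n ^ f + n * n ^ (e - Suc f)"
    unfolding e using assms(1) by simp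
  then show ?thesis using less by (simp add: digit_def)
next
  case equal
  have "(q + n ^ e) div n ^ e = Suc (q div n ^ e)" using assms(1) by simp
  moreover have "Suc (q div n ^ e mod n) < n"
  proof -
    have "n ^ e * Suc (q div n ^ e mod n) \<le> q mod n ^ Suc e + n ^ e"
      using mod_mult2_eq[of q "n ^ e" n] by (simp add: mult.commute)
    with assms(2) have "n ^ e * Suc (q div n ^ e mod n) < n ^ e * n" by (simp add: mult.commute)
    then show ?thesis by (simp only: mult_less_cancel1)
  qed
  ultimately show ?thesis using equal by (simp add: digit_def mod_Suc)
next
  case greater
  then show ?thesis using div_power_add[OF assms(2)] by (simp add: digit_def)
qed

lemma digit_max:
  assumes "n > 0" "\<not> q mod n ^ Suc e + n ^ e < n ^ Suc e"
  shows "digit n e q = n - 1"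
proof (rule ccontr)
  assume "digit n e q \<noteq> n - 1"
  then have "Suc (Suc (q div n ^ e mod n)) \<le> n"
    using digit_less[OF assms(1), of e q] by (simp add: digit_def)
  then have "n ^ e * Suc (Suc (q div n ^ e mod n)) \<le> n ^ e * n" by (rule mult_le_mono2)
  moreover have "q mod n ^ e < n ^ e" using assms(1) by simp
  ultimately show False
    using assms(2) mod_mult2_eq[of q "n ^ e" n] by (simp add: mult.commute)
qed

lemma digit_eqI:
  assumes "q < n ^ k" "r < n ^ k" "\<And>e. e < k \<Longrightarrow> digit n e q = digit n e r"
  shows "q = r"
proof -
  have "q mod n ^ e = r mod n ^ e" if "e \<le> k" for e
    using that
  proof (induction e)
    case (Suc e)
    then have "q div n ^ e mod n = r div n ^ e mod n" using assms(3)[of e] by (simp add: digit_def)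
    with Suc show ?case
      using mod_mult2_eq[of q "n ^ e" n] mod_mult2_eq[of r "n ^ e" n] by (simp add: mult.commute)
  qed simp
  from this[of k] show ?thesis using assms(1,2) by simp
qed

text \<open>If the test in \<open>incr\<close> fails, the digit is already \<open>n - 1\<close>, and
  the minimum expresses this saturation.\<close>

lemma digit_incr:
  assumes "n > 0" "j < k"
  shows "digit n e (incr n k q j) =
    (if e = k - Suc j then min (Suc (digit n e q)) (n - 1) else digit n e q)"
proof -
  have k: "k - j = Suc (k - Suc j)" using assms(2) by simp
  show ?thesis
    using digit_add[OF assms(1), of q "k - Suc j" e] digit_max[OF assms(1), of q "k - Suc j"]
      digit_less[OF assms(1), of "k - Suc j" "q + n ^ (k - Suc j)"]
    by (auto simp: incr_def k min_def simp del: power_Suc)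
qed

lemma incr_less:
  assumes "n > 0" "j < k" "q < n ^ k"
  shows "incr n k q j < n ^ k"
proof (cases "q mod n ^ (k - j) + n ^ (k - Suc j) < n ^ (k - j)")
  case True
  then have "(q + n ^ (k - Suc j)) div n ^ k = q div n ^ k"
    using div_power_add[of q n "k - Suc j" k] assms(2) by (simp add: Suc_diff_Suc)
  then show ?thesis using assms(1,3) True by (simp add: incr_def div_eq_0_iff)
qed (use assms in \<open>simp add: incr_def\<close>)

text \<open>Numbers below \<open>n ^ k\<close> are determined by their digits, and increments at
  different positions touch different digits.\<close>

lemma incr_commute:
  assumes "n > 0" "i < k" "j < k" "q < n ^ k"
  shows "incr n k (incr n k q i) j = incr n k (incr n k q j) i"
  by (rule digit_eqI[of _ n k]) (use assms in \<open>auto simp: incr_less digit_incr\<close>)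

section \<open>Runs of weakly acyclic commutative automata\<close>

lemma delta_word_simps [simp]:
  "delta_word A q [] = q"
  "delta_word A q (a # w) = delta_word A (delta A q a) w"
  "delta_word A q (u @ v) = delta_word A (delta_word A q u) v"
  by (simp_all add: delta_word_def)

lemma delta_word_in_states:
  assumes "wac_dfa Sig A" "q \<in> states A" "w \<in> lists Sig"
  shows "delta_word A q w \<in> states A"
  using assms(3,2) by (induction w arbitrary: q) (use assms(1) in \<open>auto simp: wac_dfa_def complete_dfa_def\<close>)

lemma delta_word_commute:
  assumes "wac_dfa Sig A" "q \<in> states A" "w \<in> lists Sig" "a \<in> Sig"
  shows "delta_word A (delta A q a) w = delta A (delta_word A q w) a"
  using assms(3,2)
proof (induction w arbitrary: q)
  case (Cons b w)
  have "delta A (delta A q a) b = delta A (delta A q b) a"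
    using assms(1,4) Cons by (simp add: wac_dfa_def commutative_def)
  moreover have "delta A q b \<in> states A"
    using delta_word_in_states[OF assms(1) Cons.prems, of "[b]"] Cons.hyps by simp
  ultimately show ?case using Cons.IH[of "delta A q b"] by simp
qed simp

text \<open>As long as the run on \<open>a\<close>, \<open>a\<close>, \<dots> has not entered a self-loop, each step increases
  the index of the current state in the acyclic ordering.\<close>

lemma delta_word_replicate_absorb:
  assumes A: "wac_dfa Sig A" and q: "q \<in> states A" and a: "a \<in> Sig"
    and n: "card (states A) \<le> n"
  shows "delta A (delta_word A q (replicate (n - 1) a)) a = delta_word A q (replicate (n - 1) a)"
proof -
  obtain qs where qs: "distinct qs" "set qs = states A"
    and mono: "\<And>i j a. i < length qs \<Longrightarrow> j < length qs \<Longrightarrow> a \<in> Sig \<Longrightarrow>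
      delta A (qs ! i) a = qs ! j \<Longrightarrow> i \<le> j"
    using A unfolding wac_dfa_def weakly_acyclic_def by blast
  have len: "length qs \<le> n" using qs n distinct_card[of qs] by simp
  let ?r = "\<lambda>l. delta_word A q (replicate l a)"
  have r_Suc: "?r (Suc l) = delta A (?r l) a" for l
    using delta_word_simps(3)[of A q "replicate l a" "[a]"] by (simp add: replicate_append_same)
  have index: "\<exists>i<length qs. qs ! i = ?r l" for l
  proof -
    have "?r l \<in> states A" using delta_word_in_states[OF A q, of "replicate l a"] a
      by (simp add: in_lists_conv_set)
    then show ?thesis by (simp add: qs(2)[symmetric] in_set_conv_nth)
  qed
  have climb: "delta A (?r l) a = ?r l \<or> (\<exists>i. l \<le> i \<and> i < length qs \<and> qs ! i = ?r l)" for l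
  proof (induction l)
    case 0
    show ?case using index[of 0] by auto
  next
    case (Suc l)
    show ?case
    proof (cases "delta A (?r l) a = ?r l")
      case False
      then obtain i where i: "l \<le> i" "i < length qs" "qs ! i = ?r l" using Suc by blast
      obtain i' where i': "i' < length qs" "qs ! i' = ?r (Suc l)" using index[of "Suc l"] by blast
      have "i \<le> i'" using mono[OF i(2) i'(1) a] i(3) i'(2) r_Suc by simp
      moreover have "i \<noteq> i'" using False i(3) i'(2) r_Suc by metis
      ultimately show ?thesis using i i' by (intro disjI2 exI[of _ i']) simp
    qed (use r_Suc in simp)
  qed
  \<comment> \<open>With at most \<open>n\<close> states, an index of at least \<open>n - 1\<close>
    is the last one, so the next step cannot climb further.\<close>
  from climb[of "n - 1"] show ?thesis
  proof
    assume "\<exists>i. n - 1 \<le> i \<and> i < length qs \<and> qs ! i = ?r (n - 1)"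
    then obtain i where i: "n - 1 \<le> i" "i < length qs" "qs ! i = ?r (n - 1)" by blast
    obtain i' where i': "i' < length qs" "qs ! i' = ?r (Suc (n - 1))" using index by blast
    have "i \<le> i'" using mono[OF i(2) i'(1) a] i(3) i'(2) r_Suc by simp
    then have "i = i'" using i i' len by simp
    then show ?thesis using i(3) i'(2) r_Suc by metis
  qed
qed

section \<open>The counter automaton\<close>

text \<open>The restriction to the first \<open>j\<close> letters lets the simulation be followed
  letter by letter.\<close>

definition word :: "'a list \<Rightarrow> nat \<Rightarrow> nat \<Rightarrow> nat \<Rightarrow> 'a list" where
  "word as n q j = concat (map (\<lambda>i. replicate (digit n (length as - Suc i) q) (as ! i)) [0..<j])"

definition counter_dfa :: "'a list \<Rightarrow> nat \<Rightarrow> nat set \<Rightarrow> ('a, nat) dfa" where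
  "counter_dfa as n F =
     \<lparr>alphabet = set as, states = {0..<n ^ length as},
      delta = (\<lambda>q a. incr n (length as) q (position as a)), start = 0, final = F\<rparr>"

lemma counter_dfa_simps [simp]:
  "alphabet (counter_dfa as n F) = set as"
  "states (counter_dfa as n F) = {0..<n ^ length as}"
  "delta (counter_dfa as n F) = (\<lambda>q a. incr n (length as) q (position as a))"
  "start (counter_dfa as n F) = 0"
  "final (counter_dfa as n F) = F"
  by (simp_all add: counter_dfa_def)

lemma position_less: "a \<in> set as \<Longrightarrow> position as a < length as"
  unfolding position_def by (induction as) auto

lemma nth_position: "a \<in> set as \<Longrightarrow> as ! position as a = a"
  unfolding position_def by (induction as) auto

lemma position_nth:
  assumes "distinct as" "i < length as"
  shows "position as (as ! i) = i"
  using assms nth_position[of "as ! i" as] position_less[of "as ! i" as]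
  by (simp add: nth_eq_iff_index_eq)

text \<open>An increment never lowers the number, so the usual order on numbers is an acyclic
  ordering of the states.\<close>

lemma wac_counter_dfa:
  assumes "n > 0" "F \<subseteq> {0..<n ^ length as}"
  shows "wac_dfa (set as) (counter_dfa as n F)"
proof -
  have "q \<le> incr n k q j" for q j k by (simp add: incr_def)
  then have "weakly_acyclic (counter_dfa as n F)"
    unfolding weakly_acyclic_def by (intro exI[of _ "[0..<n ^ length as]"]) auto
  then show ?thesis
    using assms by (auto simp: wac_dfa_def complete_dfa_def commutative_def incr_less
      position_less incr_commute)
qed

lemma word_in_lists: "j \<le> length as \<Longrightarrow> word as n q j \<in> lists (set as)"
  by (auto simp: word_def)

text \<open>Commutativity moves the extra letter from the end of the canonical word into its own
  block. There it lengthens the block or, if the block already has \<open>n - 1\<close> letters, is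
  absorbed.\<close>

lemma delta_word_word_incr:
  assumes A: "wac_dfa (set as) A" and card: "card (states A) \<le> n" and n: "n > 0"
    and s: "s \<in> states A" and j: "j < length as"
  shows "delta_word A s (word as n (incr n (length as) q j) (length as)) =
    delta A (delta_word A s (word as n q (length as))) (as ! j)"
proof -
  let ?f = "\<lambda>r i. replicate (digit n (length as - Suc i) r) (as ! i)"
  let ?a = "as ! j" and ?q = "incr n (length as) q j" and ?d = "digit n (length as - Suc j) q"
  define u v where "u = concat (map (?f q) [0..<j])" and "v = concat (map (?f q) [Suc j..<length as])"
  have upt: "[0..<length as] = [0..<j] @ j # [Suc j..<length as]"
    using j upt_conv_Cons[OF j] upt_add_eq_append[of 0 j "length as - j"] by simp
  have uv: "u \<in> lists (set as)" "v \<in> lists (set as)" using j by (auto simp: u_def v_def)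
  have "?f ?q i = ?f q i" if "i < length as" "i \<noteq> j" for i
  proof -
    have "length as - Suc i \<noteq> length as - Suc j" using that j by linarith
    then show ?thesis using j n by (simp add: digit_incr)
  qed
  then have "map (?f ?q) [0..<j] = map (?f q) [0..<j]"
    "map (?f ?q) [Suc j..<length as] = map (?f q) [Suc j..<length as]" using j by auto
  moreover have "word as n ?q (length as) =
      concat (map (?f ?q) [0..<j]) @ ?f ?q j @ concat (map (?f ?q) [Suc j..<length as])"
    unfolding word_def upt by simp
  ultimately have w': "word as n ?q (length as) = u @ replicate (min (Suc ?d) (n - 1)) ?a @ v"
    using digit_incr[OF n j, of "length as - Suc j" q] unfolding u_def v_def by (simp only: if_True simp_thms)
  have w: "word as n q (length as) = u @ replicate ?d ?a @ v"
    unfolding word_def upt u_def v_def by simp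
  let ?s = "delta_word A s u"
  have s': "?s \<in> states A" by (rule delta_word_in_states[OF A s uv(1)])
  let ?t = "delta_word A ?s (replicate ?d ?a)"
  have t: "?t \<in> states A"
    using j by (intro delta_word_in_states[OF A s']) (auto simp: in_lists_conv_set)
  have absorb: "delta A ?t ?a = delta_word A ?s (replicate (min (Suc ?d) (n - 1)) ?a)"
  proof (cases "Suc ?d < n")
    case True
    then have "min (Suc ?d) (n - 1) = Suc ?d" by simp
    moreover have "replicate (Suc ?d) ?a = replicate ?d ?a @ [?a]"
      by (simp add: replicate_append_same)
    ultimately show ?thesis by (simp only: delta_word_simps)
  next
    case False
    then have "?d = n - 1" using digit_less[OF n, of "length as - Suc j" q] by simp
    moreover have "?a \<in> set as" using j by simp
    ultimately show ?thesis using delta_word_replicate_absorb[OF A s' _ card, of ?a] by simp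
  qed
  have "delta A (delta_word A ?t v) ?a = delta_word A (delta A ?t ?a) v"
    using delta_word_commute[OF A t uv(2), of ?a] j by simp
  then show ?thesis by (simp only: w w' absorb delta_word_simps)
qed

text \<open>Appending a letter to \<open>w\<close> increments one digit, and the canonical word
  follows by \<open>delta_word_word_incr\<close>.\<close>

lemma delta_word_counter_dfa:
  assumes A: "wac_dfa (set as) A" and card: "card (states A) \<le> n" and n: "n > 0"
    and s: "s \<in> states A" and w: "w \<in> lists (set as)"
  shows "delta_word A s (word as n (delta_word (counter_dfa as n F) 0 w) (length as)) = delta_word A s w"
  using w
proof (induction w rule: rev_induct)
  case Nil
  have "word as n 0 (length as) = []" by (simp add: word_def digit_def)
  then show ?case by simp
next
  case (snoc a w)
  then show ?case
    using delta_word_word_incr[OF A card n s position_less[of a as]] by (simp add: nth_position)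
qed

definition intersection_final ::
  "'a list \<Rightarrow> nat \<Rightarrow> nat \<Rightarrow> (nat \<Rightarrow> ('a, 'q) dfa) \<Rightarrow> nat set" where
  "intersection_final as m n A = {q \<in> {0..<n ^ length as}.
     \<forall>i\<in>{1..m}. delta_word (A i) (start (A i)) (word as n q (length as)) \<in> final (A i)}"

lemma intersection_counter_dfa:
  assumes "distinct as" "1 \<le> m" "n > 0"
    and A: "\<And>i. i \<in> {1..m} \<Longrightarrow> wac_dfa (set as) (A i) \<and> card (states (A i)) \<le> n"
  shows "intersection_dfa (set as) m n A (counter_dfa as n (intersection_final as m n A))"
    (is "intersection_dfa _ _ _ _ ?B")
proof -
  have B: "wac_dfa (set as) ?B"
    using assms(3) by (intro wac_counter_dfa) (auto simp: intersection_final_def)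
  have start: "start (A i) \<in> states (A i)" "alphabet (A i) = set as" if "i \<in> {1..m}" for i
    using A[OF that] by (auto simp: wac_dfa_def complete_dfa_def)
  have lang_iff: "w \<in> lang ?B \<longleftrightarrow> (\<forall>i\<in>{1..m}. w \<in> lang (A i))" if w: "w \<in> lists (set as)" for w
  proof -
    let ?q = "delta_word ?B 0 w"
    have "?q < n ^ length as"
      using delta_word_in_states[OF B _ w, of 0] assms(3) by simp
    then have "?q \<in> intersection_final as m n A \<longleftrightarrow> (\<forall>i\<in>{1..m}.
        delta_word (A i) (start (A i)) (word as n ?q (length as)) \<in> final (A i))"
      by (simp only: intersection_final_def mem_Collect_eq atLeastLessThan_iff) simp
    also have "\<dots> \<longleftrightarrow> (\<forall>i\<in>{1..m}. w \<in> lang (A i))"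
    proof (rule ball_cong[OF refl])
      fix i assume i: "i \<in> {1..m}"
      have "delta_word (A i) (start (A i)) (word as n ?q (length as)) = delta_word (A i) (start (A i)) w"
        by (rule delta_word_counter_dfa[OF _ _ assms(3) start(1)[OF i] w]) (use A[OF i] in simp_all)
      then show "delta_word (A i) (start (A i)) (word as n ?q (length as)) \<in> final (A i) \<longleftrightarrow>
          w \<in> lang (A i)"
        unfolding lang_def start(2)[OF i] using w by simp
    qed
    finally have "?q \<in> intersection_final as m n A \<longleftrightarrow> (\<forall>i\<in>{1..m}. w \<in> lang (A i))" .
    then show ?thesis
      unfolding lang_def[of ?B] using w by simp
  qed
  have "lang ?B = (\<Inter>i\<in>{1..m}. lang (A i))"
  proof (rule set_eqI)
    fix w
    show "w \<in> lang ?B \<longleftrightarrow> w \<in> (\<Inter>i\<in>{1..m}. lang (A i))"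
    proof (cases "w \<in> lists (set as)")
      case True
      then show ?thesis using lang_iff by simp
    next
      \<comment> \<open>Since \<open>1 \<le> m\<close>, a word with foreign letters is kept out of
        the intersection by \<open>A 1\<close>.\<close>
      case False
      then have "w \<notin> lang ?B" "w \<notin> lang (A 1)"
        using start(2)[of 1] assms(2) by (simp_all add: lang_def)
      then show ?thesis using assms(2) by auto
    qed
  qed
  then show ?thesis
    unfolding intersection_dfa_def using B distinct_card[OF assms(1)] by simp
qed


section \<open>The encoded input\<close>

lemma nth_concat_take:
  assumes "i < length xss" "l < length (xss ! i)"
  shows "concat xss ! (length (concat (take i xss)) + l) = xss ! i ! l"
    and "length (concat (take i xss)) + l < length (concat xss)"
proof -
  have "concat xss = concat (take i xss) @ xss ! i @ concat (drop (Suc i) xss)"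
    using id_take_nth_drop[OF assms(1)] by (metis concat.simps(2) concat_append)
  then show "concat xss ! (length (concat (take i xss)) + l) = xss ! i ! l"
    "length (concat (take i xss)) + l < length (concat xss)"
    using assms(2) by (simp_all add: nth_append)
qed

lemma length_dfa_code: "length (dfa_code as qs A) = 2 + length qs + length as * length qs"
  by (simp add: dfa_code_def length_concat comp_def sum_list_triv mult.commute)

lemma dfa_code_nth:
  "dfa_code as qs A ! 0 = length qs"
  "dfa_code as qs A ! 1 = position qs (start A)"
  "p < length qs \<Longrightarrow> dfa_code as qs A ! (2 + p) = (if qs ! p \<in> final A then 1 else 0)"
  "p < length qs \<Longrightarrow> j < length as \<Longrightarrow>
    dfa_code as qs A ! (2 + length qs + length as * p + j) = position qs (delta A (qs ! p) (as ! j))"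
proof -
  assume p: "p < length qs" and j: "j < length as"
  let ?rows = "map (\<lambda>q. map (\<lambda>a. position qs (delta A q a)) as) qs"
  have "length (concat (take p ?rows)) = length as * p"
  proof -
    have "map length (take p ?rows) = replicate p (length as)"
      using p by (intro nth_equalityI) simp_all
    then show ?thesis by (simp only: length_concat sum_list_replicate) simp
  qed
  then have "concat ?rows ! (length as * p + j) = position qs (delta A (qs ! p) (as ! j))"
    using nth_concat_take(1)[of p ?rows j] p j by simp
  then show "dfa_code as qs A ! (2 + length qs + length as * p + j) =
      position qs (delta A (qs ! p) (as ! j))"
    by (simp add: dfa_code_def nth_append add.assoc)
qed (simp_all add: dfa_code_def nth_append)

text \<open>\<open>pre\<close> is the part of the input before the automata: empty if
  \<open>n\<close> is the maximum, the unary bound with its zero otherwise.\<close>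

locale encoded_input =
  fixes as :: "'a list" and m n :: nat and qs :: "nat \<Rightarrow> 'q list" and A :: "nat \<Rightarrow> ('a, 'q) dfa"
    and pre :: "nat list"
  assumes distinct: "distinct as" and m_pos: "1 \<le> m"
    and wac: "\<And>i. i \<in> {1..m} \<Longrightarrow> wac_dfa (set as) (A i)"
    and enum: "\<And>i. i \<in> {1..m} \<Longrightarrow> enumerates (qs i) (states (A i))"
    and card_le: "\<And>i. i \<in> {1..m} \<Longrightarrow> card (states (A i)) \<le> n"
begin

definition input :: "nat list" where
  "input = pre @ dfas_code as m qs A"

definition origin :: nat where
  "origin = length pre + 1"

abbreviation "mem \<equiv> heap (init_ram input)"

lemma length_qs: "i \<in> {1..m} \<Longrightarrow> length (qs i) = card (states (A i))"
  using enum distinct_card unfolding enumerates_def by metis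

lemma start_in_states: "i \<in> {1..m} \<Longrightarrow> start (A i) \<in> states (A i)"
  using wac unfolding wac_dfa_def complete_dfa_def by blast

lemma n_pos: "n > 0"
proof -
  have "finite (states (A 1))" "start (A 1) \<in> states (A 1)"
    using wac[of 1] m_pos by (auto simp: wac_dfa_def complete_dfa_def)
  then have "card (states (A 1)) > 0" by (auto simp: card_gt_0_iff)
  then show ?thesis using card_le[of 1] m_pos by simp
qed

end

sublocale encoded_input \<subseteq> program mem n "length as" m origin
  by unfold_locales (rule n_pos)

context encoded_input
begin

definition codes :: "nat list list" where
  "codes = map (\<lambda>i. dfa_code as (qs i) (A i)) [1..<Suc m]"

lemma length_codes: "length codes = m"
  by (simp add: codes_def)

lemma codes_nth: "i < m \<Longrightarrow> codes ! i = dfa_code as (qs (Suc i)) (A (Suc i))"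
  by (simp add: codes_def del: upt_Suc)

lemma input_codes: "input = (pre @ [m]) @ concat codes"
  by (simp add: input_def dfas_code_def codes_def)

lemma mem_code:
  assumes "i < m" "l < length (codes ! i)"
  shows "mem (origin + length (concat (take i codes)) + l) = codes ! i ! l"
proof -
  note c = nth_concat_take[of i codes l]
  show ?thesis
    using c assms by (simp add: init_ram_def input_codes length_codes nth_append origin_def)
qed

text \<open>The word at \<open>addr i\<close> is a number of states, so the recursion for
  \<open>addr\<close> skips exactly one code. The program numbers automata from 0, hence
  \<open>A (Suc i)\<close>.\<close>

lemma addr_eq: "i \<le> m \<Longrightarrow> addr i = origin + length (concat (take i codes))"
proof (induction i)
  case (Suc i)
  then have "mem (addr i) = length (qs (Suc i))"
    using mem_code[of i 0] by (simp add: codes_nth length_dfa_code dfa_code_nth)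
  with Suc show ?case
    by (simp add: take_Suc_conv_app_nth length_codes codes_nth length_dfa_code)
qed simp

lemma mem_addr:
  assumes "i < m" "l < 2 + length (qs (Suc i)) + length as * length (qs (Suc i))"
  shows "mem (addr i + l) = dfa_code as (qs (Suc i)) (A (Suc i)) ! l"
  using mem_code[of i l] assms by (simp add: addr_eq codes_nth length_dfa_code)

lemma mem_addr_size: "i < m \<Longrightarrow> mem (addr i) = length (qs (Suc i))"
  using mem_addr[of i 0] by (simp add: dfa_code_nth)

lemma step_eq:
  assumes i: "i < m" and s: "s \<in> states (A (Suc i))" and j: "j < length as"
  shows "step i j (position (qs (Suc i)) s) = position (qs (Suc i)) (delta (A (Suc i)) s (as ! j))"
proof -
  let ?qs = "qs (Suc i)"
  have "s \<in> set ?qs" using enum[of "Suc i"] i s by (simp add: enumerates_def)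
  then have p: "position ?qs s < length ?qs" "?qs ! position ?qs s = s"
    by (simp_all add: position_less nth_position)
  \<comment> \<open>The whole row of \<open>s\<close> lies inside the table, so the address looked
    up belongs to this automaton.\<close>
  have "length as * Suc (position ?qs s) \<le> length as * length ?qs"
    using p(1) by (intro mult_le_mono2) simp
  then have "length as * position ?qs s + j < length as * length ?qs" using j by simp
  then show ?thesis
    using mem_addr[OF i, of "2 + length ?qs + length as * position ?qs s + j"]
      dfa_code_nth(4)[OF p(1) j, of "A (Suc i)"] p(2) mem_addr_size[OF i]
    by (simp add: step_def add.assoc)
qed

lemma word_Suc: "word as n q (Suc j) = word as n q j @ replicate (digit n (length as - Suc j) q) (as ! j)"
  by (simp add: word_def)

text \<open>Following \<open>d\<close> table entries from a position mirrors \<open>d\<close>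
  transitions, so each digit of \<open>q\<close> consumes one block of the canonical word.\<close>

lemma sim_eq:
  assumes i: "i < m" and "j \<le> length as"
  shows "sim i q j =
    position (qs (Suc i)) (delta_word (A (Suc i)) (start (A (Suc i))) (word as n q j))"
  using assms(2)
proof (induction j)
  case 0
  then show ?case using mem_addr[OF i, of 1] by (simp add: dfa_code_nth[simplified] word_def)
next
  case (Suc j)
  let ?A = "A (Suc i)" and ?qs = "qs (Suc i)"
  let ?s = "delta_word ?A (start ?A) (word as n q j)"
  have A: "wac_dfa (set as) ?A" using wac i by simp
  have s: "?s \<in> states ?A"
    using Suc.prems i by (intro delta_word_in_states[OF A] start_in_states word_in_lists) simp_all
  have "(step i j ^^ d) (position ?qs ?s) = position ?qs (delta_word ?A ?s (replicate d (as ! j)))" for d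
  proof (induction d)
    case (Suc d)
    have "delta_word ?A ?s (replicate d (as ! j)) \<in> states ?A"
      using \<open>Suc j \<le> length as\<close> by (intro delta_word_in_states[OF A s]) (auto simp: in_lists_conv_set)
    moreover have "replicate (Suc d) (as ! j) = replicate d (as ! j) @ [as ! j]"
      by (simp add: replicate_append_same)
    ultimately show ?case
      using Suc step_eq[OF i] \<open>Suc j \<le> length as\<close> by (simp del: replicate.simps)
  qed simp
  then show ?case using Suc by (simp add: word_Suc)
qed

lemma accepted_eq:
  assumes "q < n ^ length as"
  shows "accepted q m = (if q \<in> intersection_final as m n A then 1 else 0)"
proof -
  let ?s = "\<lambda>i. delta_word (A i) (start (A i)) (word as n q (length as))"
  have "mem (addr i + 2 + sim i q (length as)) \<noteq> 0 \<longleftrightarrow> ?s (Suc i) \<in> final (A (Suc i))"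
    if i: "i < m" for i
  proof -
    let ?qs = "qs (Suc i)"
    have "?s (Suc i) \<in> states (A (Suc i))"
      using i by (intro delta_word_in_states[OF wac] start_in_states word_in_lists) simp_all
    then have "?s (Suc i) \<in> set ?qs" using enum[of "Suc i"] i by (simp add: enumerates_def)
    then have p: "position ?qs (?s (Suc i)) < length ?qs" "?qs ! position ?qs (?s (Suc i)) = ?s (Suc i)"
      by (simp_all add: position_less nth_position)
    then show ?thesis
      using mem_addr[OF i, of "2 + position ?qs (?s (Suc i))"]
        dfa_code_nth(3)[OF p(1), of as "A (Suc i)"] sim_eq[OF i, of "length as" q]
      by (simp add: add.assoc)
  qed
  then have "(\<forall>i<m. mem (addr i + 2 + sim i q (length as)) \<noteq> 0) \<longleftrightarrow>
      (\<forall>i<m. ?s (Suc i) \<in> final (A (Suc i)))" by blast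
  also have "\<dots> \<longleftrightarrow> (\<forall>i\<in>{1..m}. ?s i \<in> final (A i))"
  proof -
    have "{1..m} = Suc ` {..<m}" by (simp add: image_Suc_lessThan)
    then show ?thesis by auto
  qed
  finally show ?thesis using assms by (simp only: accepted_def intersection_final_def) simp
qed

lemma position_upt: "q < N \<Longrightarrow> position [0..<N] q = q"
  using position_nth[of "[0..<N]" q] by simp

text \<open>In the enumeration of the states by size each number is its own position, so the printed
  numbers need no translation.\<close>

lemma result_eq:
  "result = dfa_code as [0..<n ^ length as] (counter_dfa as n (intersection_final as m n A))"
proof -
  have row: "map (incr n (length as) q) [0..<length as] =
      map (\<lambda>a. position [0..<n ^ length as] (incr n (length as) q (position as a))) as"
    if "q < n ^ length as" for q
    using that n_pos distinct by (intro nth_equalityI) (simp_all add: position_nth incr_less position_upt)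
  have start: "position [0..<n ^ length as] 0 = 0" using n_pos by (simp add: position_upt)
  have bits: "map (\<lambda>q. accepted q m) [0..<n ^ length as] =
      map (\<lambda>q. if q \<in> intersection_final as m n A then 1 else 0) [0..<n ^ length as]"
    by (simp add: accepted_eq)
  have rows: "map (\<lambda>q. map (incr n (length as) q) [0..<length as]) [0..<n ^ length as] =
      map (\<lambda>q. map (\<lambda>a. position [0..<n ^ length as] (incr n (length as) q (position as a))) as)
        [0..<n ^ length as]"
    by (simp add: row)
  show ?thesis
    by (simp only: result_def dfa_code_def counter_dfa_simps start bits rows length_upt
        minus_nat.diff_0)
qed

lemma result_in_codes: "result \<in> intersection_codes as m n A"
proof -
  have "enumerates [0..<n ^ length as]
      (states (counter_dfa as n (intersection_final as m n A)))"
    by (simp add: enumerates_def)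
  then show ?thesis
    using intersection_counter_dfa[of as m n A, OF distinct m_pos n_pos] wac card_le result_eq
    unfolding intersection_codes_def by blast
qed

text \<open>No code is empty, so each automaton contributes at least one word.\<close>

lemma length_input: "length input \<ge> length pre + m"
proof -
  have "sum_list (map (\<lambda>_. 1) codes) \<le> sum_list (map length codes)"
    by (rule sum_list_mono) (auto simp: codes_def length_dfa_code simp del: upt_Suc)
  then show ?thesis by (simp add: input_codes length_concat sum_list_triv length_codes)
qed

end

section \<open>Running time as a polynomial in the input length\<close>

definition time_poly :: "nat \<Rightarrow> nat poly" where
  "time_poly k = (let X = [:0, 1:]; K = [:k:] in
     [:11:] + X * ([:17:] + K) + [:16:] + K * ([:5:] + X * [:4:]) +
     X ^ k * (1 + ([:11:] + X * (1 + ([:21:] + K + K * ([:4:] + X * ([:10:] + K)))))) +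
     X ^ k * (1 + ([:6:] + K * ([:13:] + X * [:6:]))))"

context encoded_input
begin

text \<open>The time bounds are monotone, so \<open>l\<close> may replace both \<open>n\<close> and
  \<open>m\<close>. The limit on \<open>t\<close> dominates both input phases,
  \<open>11 + m * (13 + k)\<close> and \<open>9 + n * 4\<close>.\<close>

lemma time_le:
  assumes "n \<le> l" "m \<le> l" "t \<le> 11 + l * (17 + length as)"
  shows "t + output_time \<le> poly (time_poly (length as)) l"
proof -
  let ?k = "length as"
  have n_power: "n ^ ?k \<le> l ^ ?k" using assms(1) by (rule power_mono) simp
  have "t + output_time \<le> (11 + l * (17 + ?k)) + (16 + ?k * (5 + l * 4) +
      l ^ ?k * (1 + (11 + l * (1 + (21 + ?k + ?k * (4 + l * (10 + ?k)))))) +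
      l ^ ?k * (1 + (6 + ?k * (13 + l * 6))))"
    unfolding output_time_def bit_time_def row_time_def dfa_time_def
    by (intro add_mono mult_mono order_refl assms n_power zero_le)
  also have "\<dots> = poly (time_poly ?k) l"
    by (simp add: time_poly_def Let_def algebra_simps)
  finally show ?thesis .
qed

lemma solves:
  assumes c: "triple (\<lambda>s. heap s = mem \<and> out s = []) c t (\<lambda>s. base 0 s \<and> out s = [])"
    and "n \<le> length input" "t \<le> 11 + length input * (17 + length as)"
  shows "\<exists>t s. big_step (Seq c (output_prog (length as))) (init_ram input) t s \<and>
     t \<le> poly (time_poly (length as)) (length input) \<and> out s \<in> intersection_codes as m n A"
proof -
  let ?c = "Seq c (output_prog (length as))"
  have "heap (init_ram input) = mem \<and> out (init_ram input) = []" by (simp add: init_ram_def)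
  then have "\<exists>t' s. big_step ?c (init_ram input) t' s \<and> t' \<le> t + output_time \<and> out s = result"
    using triple_Seq[OF c output_prog] unfolding triple_def by simp
  then obtain t' s where *: "big_step ?c (init_ram input) t' s" "t' \<le> t + output_time" "out s = result"
    by (elim exE conjE)
  have "t + output_time \<le> poly (time_poly (length as)) (length input)"
    using assms(2,3) length_input by (intro time_le) auto
  then have "t' \<le> poly (time_poly (length as)) (length input)" using *(2) by simp
  moreover have "out s \<in> intersection_codes as m n A"
    unfolding *(3) by (rule result_in_codes)
  ultimately show ?thesis using *(1) by (intro exI conjI)
qed

end

lemma max_instances_solvable:
  assumes "distinct as"
  shows "poly_time_solvable (max_instances as TYPE('q))"
  unfolding poly_time_solvable_def
proof (intro exI ballI, clarify)
  fix xs Y assume "(xs, Y) \<in> max_instances as TYPE('q)"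
  then obtain m n and qs :: "nat \<Rightarrow> 'q list" and A :: "nat \<Rightarrow> ('a, 'q) dfa"
    where xs: "xs = dfas_code as m qs A" and Y: "Y = intersection_codes as m n A" and m: "1 \<le> m"
      and A: "\<forall>i\<in>{1..m}. wac_dfa (set as) (A i) \<and> enumerates (qs i) (states (A i))"
      and n: "n = Max ((\<lambda>i. card (states (A i))) ` {1..m})"
    unfolding max_instances_def by blast
  interpret encoded_input as m n qs A "[]"
    by unfold_locales (use assms m A in \<open>auto simp: n\<close>)
  have xs': "xs = input" by (simp add: xs input_def)
  \<comment> \<open>\<open>insert 0\<close> gives \<open>Max\<close> a nonempty set at
    \<open>i = 0\<close>, in line with \<open>max_size 0 = 0\<close>.\<close>
  have max_size: "max_size i = Max (insert 0 ((\<lambda>i. card (states (A i))) ` {1..i}))" if "i \<le> m" for i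
    using that
  proof (induction i)
    case (Suc i)
    let ?f = "\<lambda>i. card (states (A i))"
    have "max_size (Suc i) = max (?f (Suc i)) (Max (insert 0 (?f ` {1..i})))"
      using Suc mem_addr_size[of i] length_qs[of "Suc i"] by (simp add: max.commute)
    also have "\<dots> = Max (insert (?f (Suc i)) (insert 0 (?f ` {1..i})))"
      by (rule Max_insert[symmetric]) simp_all
    also have "\<dots> = Max (insert 0 (?f ` {1..Suc i}))"
      by (rule arg_cong[where f = Max]) (auto simp: atLeastAtMostSuc_conv)
    finally show ?case .
  qed simp
  have n': "max_size m = n"
    using max_size[of m] m by (simp add: n)
  \<comment> \<open>The maximum is attained, and the code of that automaton alone has at least
    \<open>n\<close> words; this bounds \<open>n\<close> by the input length.\<close>
  obtain i where i: "i \<in> {1..m}" "n = card (states (A i))"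
  proof -
    have "n \<in> (\<lambda>i. card (states (A i))) ` {1..m}"
      unfolding n using m by (intro Max_in) auto
    then show ?thesis using that by blast
  qed
  then have i': "i - 1 < m" "Suc (i - 1) = i" by auto
  have "n \<le> length (codes ! (i - 1))"
    using length_qs[OF i(1)] i(2) unfolding codes_nth[OF i'(1)] i'(2) by (simp add: length_dfa_code)
  also have "\<dots> \<le> length input"
    using nth_mem[of "i - 1" codes] i(1) by (auto simp: input_codes length_concat length_codes
      intro!: le_SucI member_le_sum_list)
  finally have n_le: "n \<le> length input" .
  have time: "11 + m * (13 + length as) \<le> 11 + length input * (17 + length as)"
    using length_input by (intro add_mono mult_mono) auto
  have layout: "mem 0 = m" "origin = 1" by (simp_all add: init_ram_def input_codes origin_def)
  \<comment> \<open>The program and the polynomial, left open by \<open>exI\<close>, are fixed here;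
    they depend on \<open>length as\<close> only.\<close>
  show "\<exists>t s. big_step (Seq (max_input (length as)) (output_prog (length as))) (init_ram xs) t s \<and>
      t \<le> poly (time_poly (length as)) (length xs) \<and> out s \<in> Y"
    unfolding xs' Y by (rule solves[OF max_input[OF layout n'] n_le time])
qed

lemma bound_instances_solvable:
  assumes "distinct as"
  shows "poly_time_solvable (bound_instances as TYPE('q))"
  unfolding poly_time_solvable_def
proof (intro exI ballI, clarify)
  fix xs Y assume "(xs, Y) \<in> bound_instances as TYPE('q)"
  then obtain m n and qs :: "nat \<Rightarrow> 'q list" and A :: "nat \<Rightarrow> ('a, 'q) dfa"
    where xs: "xs = replicate n 1 @ [0] @ dfas_code as m qs A"
      and Y: "Y = intersection_codes as m n A" and m: "1 \<le> m"
      and A: "\<forall>i\<in>{1..m}. wac_dfa (set as) (A i) \<and> enumerates (qs i) (states (A i))"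
      and n: "\<forall>i\<in>{1..m}. card (states (A i)) \<le> n"
    unfolding bound_instances_def by blast
  define pre :: "nat list" where "pre = replicate n 1 @ [0]"
  interpret encoded_input as m n qs A pre
    by unfold_locales (use assms m A n in auto)
  have xs': "xs = input" unfolding xs input_def unfolding pre_def by simp
  have pre: "length pre = n + 1" "\<And>i. i < n \<Longrightarrow> pre ! i = 1" "pre ! n = 0"
    by (simp_all add: pre_def nth_append)
  have n_le: "n \<le> length input" using length_input pre(1) by simp
  have "9 + n * 4 \<le> 11 + length input * (17 + length as)"
    using n_le by (intro add_mono mult_mono) auto
  moreover have "mem i = 1" if "i < n" for i
    using that by (simp add: init_ram_def input_codes nth_append pre)
  moreover have "mem n = 0" "mem (n + 1) = m" "origin = n + 2"
    by (simp_all add: init_ram_def input_codes nth_append pre origin_def)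
  ultimately show "\<exists>t s. big_step (Seq bound_input (output_prog (length as))) (init_ram xs) t s \<and>
      t \<le> poly (time_poly (length as)) (length xs) \<and> out s \<in> Y"
    unfolding xs' Y by (intro solves[OF bound_input n_le]) simp_all
qed

theorem proposition3p7:
  fixes Sig :: "'a set"
  assumes "finite Sig"
  shows "(\<forall>m n (A :: nat \<Rightarrow> ('a, 'q) dfa).
            1 \<le> m \<longrightarrow>
            (\<forall>i\<in>{1..m}. wac_dfa Sig (A i) \<and> card (states (A i)) \<le> n) \<longrightarrow>
            (\<exists>B :: ('a, nat) dfa. intersection_dfa Sig m n A B)) \<and>
         (\<forall>as. enumerates as Sig \<longrightarrow>
            poly_time_solvable (max_instances as TYPE('q)) \<and>
            poly_time_solvable (bound_instances as TYPE('q)))"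
proof (intro conjI allI impI)
  fix m n and A :: "nat \<Rightarrow> ('a, 'q) dfa"
  assume m: "1 \<le> m" and A: "\<forall>i\<in>{1..m}. wac_dfa Sig (A i) \<and> card (states (A i)) \<le> n"
  obtain as where as: "set as = Sig" "distinct as"
    using finite_distinct_list[OF assms] by blast
  \<comment> \<open>The start state of \<open>A 1\<close> forces \<open>n > 0\<close>, which the
    counter automaton requires.\<close>
  have "finite (states (A 1))" "start (A 1) \<in> states (A 1)"
    using A m by (auto simp: wac_dfa_def complete_dfa_def)
  then have "card (states (A 1)) > 0" by (auto simp: card_gt_0_iff)
  moreover have "card (states (A 1)) \<le> n" using bspec[OF A, of 1] m by simp
  ultimately have "n > 0" by simp
  then show "\<exists>B :: ('a, nat) dfa. intersection_dfa Sig m n A B"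
    using intersection_counter_dfa[of as m n A] as m A by blast
qed (auto simp: enumerates_def intro: max_instances_solvable bound_instances_solvable)

end
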